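(* Let $T\subset\mathbb{R}^2$ be any triangle, let $S\subseteq\mathbb{R}^2$ be any subset of the plane, and let $\mathcal{P}=\{P_i : i\in I\}$ be a finite collection of homothetic copies of $T$ that is a $12$-fold covering of $S$. Then $\mathcal{P}$ can be decomposed into two coverings of $S$, i.e. there is a partition $I=I_1\sqcup I_2$ such that each of $\{P_i : i\in I_1\}$ and $\{P_i: i\in I_2\}$ is a covering of $S$.
   Context: A triangle is a nondegenerate triangular region in the plane: the convex hull of three non-collinear points (closed triangle) or its interior (open triangle). A homothetic copy of $T$ is a set $\lambda T+v$ with $\lambda>0$ and $v\in\mathbb{R}^2$. A collection $\{P_i : i\in I\}$ of sets is an $m$-fold covering of a set $S$ if every point of $S$ is contained in at least $m$ members of the collection (i.e. in $P_i$ for at least $m$ indices $i$); a $1$-fold covering is called a covering. *)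

theory Defs
  imports "HOL-Analysis.Analysis"
begin

definition plane_triangle :: "(real^2) set \<Rightarrow> bool" where
  "plane_triangle T \<longleftrightarrow> (\<exists>a b c. \<not> collinear {a, b, c} \<and>
     (T = convex hull {a, b, c} \<or> T = interior (convex hull {a, b, c})))"

definition homothetic_copy :: "(real^2) set \<Rightarrow> (real^2) set \<Rightarrow> bool" where
  "homothetic_copy T Q \<longleftrightarrow> (\<exists>c v. c > 0 \<and> Q = (\<lambda>x. c *\<^sub>R x + v) ` T)"

text \<open>
  Multiplicities are counted by indices, so repeated members count separately.
  Asking for a subset of exactly \<open>m\<close> indices keeps the notion meaningful for infinite
  index sets, where \<open>card\<close> is no use.
\<close>
definition fold_covering :: "nat \<Rightarrow> 'i set \<Rightarrow> ('i \<Rightarrow> 'a set) \<Rightarrow> 'a set \<Rightarrow> bool" where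
  "fold_covering m I P S \<longleftrightarrow>
     (\<forall>x\<in>S. \<exists>J\<subseteq>I. finite J \<and> card J = m \<and> (\<forall>i\<in>J. x \<in> P i))"

definition covering :: "'i set \<Rightarrow> ('i \<Rightarrow> 'a set) \<Rightarrow> 'a set \<Rightarrow> bool" where
  "covering I P S \<longleftrightarrow> fold_covering 1 I P S"

end

theory Submission
  imports Defs
begin

text \<open>
  The triangle is an intersection of three half-planes, so the indices of the copies containing a
  given point are cut out by three thresholds. Two of them are coordinates \<open>x\<close>, \<open>y\<close> of a point of
  the plane and the third is its time of arrival; we must 2-colour the points so that at any time
  every lower-left quadrant with at least 12 points sees both colours.

  The colour of a new minimal point (a \<^emph>\<open>blank\<close>) is left open. When a point arrives below some
  blanks, they are tied to the opposite of its still open colour, so that a quadrant containing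
  one of them has both colours whatever is decided later; a point arriving above another one simply
  takes the opposite colour. If a quadrant that is not yet known to be bichromatic collects six
  blanks, one or two of them are coloured, opposite to their neighbours in the antichain \<open>S\<close> of
  coloured points. With six blanks there is always a choice for which each point thereby expelled
  from \<open>S\<close> without obtaining an opposite colour below it lies above a second blank. Hence an
  undecided quadrant has at most 5 blanks, 1 point of \<open>S\<close> and, charged to distinct blanks, 5
  expelled points: 11 in total.
\<close>

section \<open>Configurations of blank and coloured points\<close>

definition bichromatic :: "('i \<Rightarrow> bool) \<Rightarrow> 'i set \<Rightarrow> bool" where
  "bichromatic c W \<longleftrightarrow> (\<exists>i\<in>W. \<exists>j\<in>W. c i \<noteq> c j)"

lemma bichromaticI: "i \<in> W \<Longrightarrow> j \<in> W \<Longrightarrow> c i \<noteq> c j \<Longrightarrow> bichromatic c W"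
  by (auto simp: bichromatic_def)

lemma bichromatic_cong:
  "(\<And>i. i \<in> W \<Longrightarrow> c i = c' i) \<Longrightarrow> bichromatic c W = bichromatic c' W"
  by (auto simp: bichromatic_def)

text \<open>Natural coordinates suffice because only the order of the thresholds matters.
  Injectivity is general position: incomparable points are strictly ordered, oppositely in
  \<open>x\<close> and \<open>y\<close>.\<close>

locale quadrants =
  fixes x y :: "'i \<Rightarrow> nat" and I :: "'i set"
  assumes inj_x: "inj_on x I" and inj_y: "inj_on y I" and fin_I: "finite I"
begin

definition quad :: "'i set \<Rightarrow> nat \<Rightarrow> nat \<Rightarrow> 'i set" where
  "quad X a b = {i \<in> X. x i < a \<and> y i < b}"

definition below :: "'i \<Rightarrow> 'i \<Rightarrow> bool" where
  "below p q \<longleftrightarrow> x p \<le> x q \<and> y p \<le> y q"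

text \<open>These are the undecided sets: some colouring of the blanks still leaves them
  monochromatic.\<close>

definition free :: "'i set \<Rightarrow> 'i set \<Rightarrow> ('i \<Rightarrow> bool) \<Rightarrow> 'i set \<Rightarrow> bool" where
  "free B C f W \<longleftrightarrow> W \<subseteq> B \<union> C \<and> \<not> bichromatic f (W \<inter> C)"

text \<open>
  \<open>X\<close> are the points present, \<open>B\<close> the blanks, \<open>S\<close> the coloured antichain, \<open>D\<close> the points expelled
  from it, and \<open>f\<close> colours \<open>S \<union> D\<close>. The remaining points of \<open>X\<close> have a point of the opposite colour
  below them in every admissible colouring. Only blanks not below \<open>S\<close> are counted in the last
  clause: the blank that expels a point of \<open>S\<close> is itself no longer available, but it was not counted.
\<close>
definition balanced :: "'i set \<Rightarrow> 'i set \<Rightarrow> 'i set \<Rightarrow> 'i set \<Rightarrow> ('i \<Rightarrow> bool) \<Rightarrow> bool" where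
  "balanced X B S D f \<longleftrightarrow>
     X \<subseteq> I \<and> B \<union> S \<union> D \<subseteq> X \<and> B \<inter> S = {} \<and> B \<inter> D = {} \<and> S \<inter> D = {} \<and>
     (\<forall>b\<in>B. \<forall>p\<in>X. below p b \<longrightarrow> p = b) \<and>
     (\<forall>s\<in>S. \<forall>t\<in>S. below s t \<longrightarrow> s = t) \<and>
     (\<forall>d\<in>D. \<exists>s\<in>S. below s d) \<and>
     (\<forall>a b. free B (S \<union> D) f (quad X a b) \<longrightarrow>
        (\<forall>s\<in>quad X a b \<inter> S. \<forall>t\<in>quad X a b \<inter> S. s = t) \<and>
        card (quad X a b \<inter> D) \<le>
          card {p \<in> quad X a b \<inter> B. \<forall>s\<in>quad X a b \<inter> S. \<not> below p s})"

text \<open>Fixing more colours can only destroy freeness, so bounds known before a promotion apply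
  to every quadrant that is free after it.\<close>

lemma free_recolour:
  assumes "free (B - P) (C \<union> P) f' W" and "P \<subseteq> B" and "\<And>i. i \<in> C \<Longrightarrow> f' i = f i"
  shows "free B C f W"
proof -
  have "\<not> bichromatic f' (W \<inter> C)" "W \<subseteq> B \<union> C"
    using assms(1,2) unfolding free_def bichromatic_def by blast+
  moreover have "bichromatic f (W \<inter> C) = bichromatic f' (W \<inter> C)"
    using assms(3) by (intro bichromatic_cong) simp
  ultimately show ?thesis by (simp add: free_def)
qed

lemma below_refl [simp]: "below p p"
  by (simp add: below_def)

lemma below_trans: "below p q \<Longrightarrow> below q r \<Longrightarrow> below p r"
  by (auto simp: below_def)

lemma quad_down: "q \<in> quad X a b \<Longrightarrow> below p q \<Longrightarrow> p \<in> X \<Longrightarrow> p \<in> quad X a b"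
  by (auto simp: quad_def below_def)

lemma incomparable:
  assumes "p \<in> I" "q \<in> I" "\<not> below p q" "\<not> below q p"
  shows "x p < x q \<and> y q < y p \<or> x q < x p \<and> y p < y q"
  using assms inj_onD[OF inj_x] inj_onD[OF inj_y] unfolding below_def by force

lemma finite_sub: "X \<subseteq> I \<Longrightarrow> finite X"
  using fin_I finite_subset by blast

text \<open>
  The nearest point of \<open>S\<close> to the left of \<open>p\<close> (in the direction of \<open>x\<close>) has colour \<open>k\<close>; vacuously true
  for both colours if there is none. Likewise to the right, where \<open>y\<close> decreases along an antichain.
\<close>
definition left_colour :: "'i set \<Rightarrow> ('i \<Rightarrow> bool) \<Rightarrow> 'i \<Rightarrow> bool \<Rightarrow> bool" where
  "left_colour S f p k \<longleftrightarrow>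
     (\<forall>t\<in>S. x t < x p \<longrightarrow> (\<exists>v\<in>S. x t \<le> x v \<and> x v < x p \<and> f v = k))"

definition right_colour :: "'i set \<Rightarrow> ('i \<Rightarrow> bool) \<Rightarrow> 'i \<Rightarrow> bool \<Rightarrow> bool" where
  "right_colour S f p k \<longleftrightarrow>
     (\<forall>t\<in>S. y t < y p \<longrightarrow> (\<exists>v\<in>S. y t \<le> y v \<and> y v < y p \<and> f v = k))"

lemma nearest_below:
  fixes h :: "'i \<Rightarrow> nat"
  assumes "finite S"
  shows "\<exists>k. \<forall>t\<in>S. h t < n \<longrightarrow> (\<exists>v\<in>S. h t \<le> h v \<and> h v < n \<and> f v = (k::bool))"
proof (cases "{t\<in>S. h t < n} = {}")
  case False
  let ?A = "{t\<in>S. h t < n}"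
  have fin: "finite (h ` ?A)" using assms by simp
  with False obtain v where v: "v \<in> ?A" "h v = Max (h ` ?A)"
    using Max_in[OF fin] by (metis (no_types, lifting) imageE image_is_empty)
  then have "h t \<le> h v" if "t \<in> ?A" for t
    using that fin by simp
  with v show ?thesis by blast
qed auto

lemma left_colour_ex: "S \<subseteq> I \<Longrightarrow> \<exists>k. left_colour S f p k"
  unfolding left_colour_def by (rule nearest_below[OF finite_sub])

lemma right_colour_ex: "S \<subseteq> I \<Longrightarrow> \<exists>k. right_colour S f p k"
  unfolding right_colour_def by (rule nearest_below[OF finite_sub])

lemma balancedD:
  assumes "balanced X B S D f"
  shows "X \<subseteq> I" "B \<subseteq> X" "S \<subseteq> X" "D \<subseteq> X" "B \<inter> S = {}" "B \<inter> D = {}" "S \<inter> D = {}"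
    "\<And>b p. b \<in> B \<Longrightarrow> p \<in> X \<Longrightarrow> below p b \<Longrightarrow> p = b"
    "\<And>s t. s \<in> S \<Longrightarrow> t \<in> S \<Longrightarrow> below s t \<Longrightarrow> s = t"
    "\<And>d. d \<in> D \<Longrightarrow> \<exists>s\<in>S. below s d"
    "\<And>a b s t. free B (S \<union> D) f (quad X a b) \<Longrightarrow> s \<in> quad X a b \<Longrightarrow> s \<in> S \<Longrightarrow>
        t \<in> quad X a b \<Longrightarrow> t \<in> S \<Longrightarrow> s = t"
    "\<And>a b. free B (S \<union> D) f (quad X a b) \<Longrightarrow> card (quad X a b \<inter> D) \<le>
          card {p \<in> quad X a b \<inter> B. \<forall>s\<in>quad X a b \<inter> S. \<not> below p s}"
proof -
  note parts = assms[unfolded balanced_def]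
  note sets = parts[THEN conjunct1] parts[THEN conjunct2, THEN conjunct1]
    parts[THEN conjunct2, THEN conjunct2]
  note m = sets(3)[THEN conjunct2, THEN conjunct2, THEN conjunct2]
  show "X \<subseteq> I" "B \<subseteq> X" "S \<subseteq> X" "D \<subseteq> X" "B \<inter> S = {}" "B \<inter> D = {}" "S \<inter> D = {}"
    using sets(1,2) sets(3)[THEN conjunct1] sets(3)[THEN conjunct2, THEN conjunct1]
      sets(3)[THEN conjunct2, THEN conjunct2, THEN conjunct1] by blast+
  show "\<And>b p. b \<in> B \<Longrightarrow> p \<in> X \<Longrightarrow> below p b \<Longrightarrow> p = b"
    using m[THEN conjunct1] by blast
  show "\<And>s t. s \<in> S \<Longrightarrow> t \<in> S \<Longrightarrow> below s t \<Longrightarrow> s = t"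
    using m[THEN conjunct2, THEN conjunct1] by blast
  show "\<And>d. d \<in> D \<Longrightarrow> \<exists>s\<in>S. below s d"
    using m[THEN conjunct2, THEN conjunct2, THEN conjunct1] by blast
  note q = m[THEN conjunct2, THEN conjunct2, THEN conjunct2, rule_format]
  show "s = t" if "free B (S \<union> D) f (quad X a b)" "s \<in> quad X a b" "s \<in> S"
    "t \<in> quad X a b" "t \<in> S" for a b s t
    using q[OF that(1), THEN conjunct1] that by blast
  show "card (quad X a b \<inter> D) \<le>
      card {p \<in> quad X a b \<inter> B. \<forall>s\<in>quad X a b \<inter> S. \<not> below p s}"
    if "free B (S \<union> D) f (quad X a b)" for a b
    using q[OF that, THEN conjunct2] .
qed

section \<open>Turning blanks into coloured points\<close>

text \<open>A quadrant free afterwards was free before, so it held at most one point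
  \<open>u\<close> of \<open>S\<close> and at most one is expelled. By \<open>two\<close>, a second
  blank lies below \<open>u\<close>. It was not counted while \<open>u\<close> was in
  \<open>S\<close>, but it counts now and pays for the new member of \<open>D\<close>.\<close>

lemma balanced_promote:
  assumes st: "balanced X B S D f"
    and P: "P \<subseteq> B"
    and S': "S' = {s \<in> S. \<forall>p\<in>P. \<not> below p s} \<union> P"
    and f': "\<And>i. i \<in> S \<union> D \<Longrightarrow> f' i = f i"
    and one: "\<And>a b s t. free (B - P) (S \<union> D \<union> P) f' (quad X a b) \<Longrightarrow>
      s \<in> quad X a b \<inter> S' \<Longrightarrow> t \<in> quad X a b \<inter> S' \<Longrightarrow> s = t"
    and two: "\<And>p u. p \<in> P \<Longrightarrow> u \<in> S \<Longrightarrow> below p u \<Longrightarrow> \<exists>q\<in>B. q \<noteq> p \<and> below q u"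
  shows "balanced X (B - P) S' (D \<union> (S - S')) f'"
proof -
  note sD = balancedD[OF st]
  have C: "S' \<union> (D \<union> (S - S')) = S \<union> D \<union> P" using S' by auto
  have shadow: "card (quad X a b \<inter> (D \<union> (S - S'))) \<le>
      card {p \<in> quad X a b \<inter> (B - P). \<forall>s\<in>quad X a b \<inter> S'. \<not> below p s}"
    if fr': "free (B - P) (S \<union> D \<union> P) f' (quad X a b)" for a b
  proof -
    let ?W = "quad X a b"
    have finW: "finite ?W"
      using finite_sub[OF sD(1)] by (simp add: quad_def)
    have fr: "free B (S \<union> D) f ?W"
      using free_recolour[OF fr' P f'] .
    show ?thesis
    proof (cases "?W \<inter> P = {}")
      case True
      then have "?W \<inter> S' = ?W \<inter> S"
        using S' quad_down P sD(2) by blast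
      moreover from this have "?W \<inter> (D \<union> (S - S')) = ?W \<inter> D" by auto
      moreover have "?W \<inter> (B - P) = ?W \<inter> B" using True by auto
      ultimately show ?thesis using sD(12)[OF fr] by simp
    next
      case False
      then obtain p where p: "p \<in> ?W" "p \<in> P" by auto
      have pS': "p \<in> S'" using p S' by auto
      have W1: "?W \<inter> S' = {p}" using one[OF fr'] p pS' by blast
      have WP: "?W \<inter> P = {p}" using W1 p S' by blast
      \<comment> \<open>Blanks are minimal, so no other blank lies below \<open>p\<close>, and all
        blanks left in \<open>?W\<close> are counted.\<close>
      have T': "{q \<in> ?W \<inter> (B - P). \<forall>s\<in>?W \<inter> S'. \<not> below q s} = ?W \<inter> B - {p}"
        using W1 WP p P sD(8)[of p] subsetD[OF sD(2)] by auto
      show ?thesis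
      proof (cases "?W \<inter> S = {}")
        case True
        have "?W \<inter> D = {}"
          using sD(10) sD(3) quad_down True by blast
        then have "?W \<inter> (D \<union> (S - S')) = {}" using True by auto
        then show ?thesis by simp
      next
        case False
        then obtain u where u: "u \<in> ?W" "u \<in> S" by auto
        then have WS: "?W \<inter> S = {u}" using sD(11)[OF fr] by blast
        have "u \<noteq> p" using u p P sD(5) by auto
        then have "u \<notin> S'" using W1 u by auto
        then obtain p' where p': "p' \<in> P" "below p' u" using S' u by auto
        then have "p' \<in> ?W" using quad_down[OF u(1)] P sD(2) by auto
        then have pu: "below p u" using WP p' by auto
        obtain q where q: "q \<in> B" "q \<noteq> p" "below q u" using two[OF p(2) u(2) pu] by auto
        \<comment> \<open>In \<open>?W\<close> the only promoted blank is \<open>p\<close>, so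
          \<open>q\<close> is still a blank afterwards.\<close>
        have qW: "q \<in> ?W" using quad_down[OF u(1) q(3)] q sD(2) by auto
        let ?T = "{q \<in> ?W \<inter> B. \<forall>s\<in>?W \<inter> S. \<not> below q s}"
        have finT: "finite ?T" using finW by simp
        have "insert q ?T \<subseteq> ?W \<inter> B - {p}" using qW q pu u WS by auto
        moreover have "q \<notin> ?T" using q u by auto
        ultimately have "card ?T + 1 \<le> card (?W \<inter> B - {p})"
          using card_mono[of "?W \<inter> B - {p}" "insert q ?T"] finW finT by simp
        moreover have "?W \<inter> (D \<union> (S - S')) = insert u (?W \<inter> D)"
          using WS \<open>u \<notin> S'\<close> u by auto
        then have "card (?W \<inter> (D \<union> (S - S'))) \<le> card (?W \<inter> D) + 1"
          using finW by (simp add: card_insert_if)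
        ultimately show ?thesis using sD(12)[OF fr] T' by simp
      qed
    qed
  qed
  have dsub: "\<exists>s\<in>S'. below s d" if d: "d \<in> D \<union> (S - S')" for d
  proof -
    obtain s where s: "s \<in> S" "below s d"
      using d sD(10)[of d] below_refl[of d] by blast
    show ?thesis
    proof (cases "s \<in> S'")
      case False
      then obtain p where "p \<in> P" "below p s" using s S' by auto
      then show ?thesis using s S' below_trans by blast
    qed (use s in auto)
  qed
  have anti: "s = t" if "s \<in> S'" "t \<in> S'" "below s t" for s t
    using that S' P sD(2,3) sD(8)[of t s] sD(9)[of s t] by auto
  show ?thesis
    unfolding balanced_def C
  proof (intro conjI allI impI ballI)
    show "X \<subseteq> I" "B - P \<union> S' \<union> (D \<union> (S - S')) \<subseteq> X" "(B - P) \<inter> S' = {}"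
      "(B - P) \<inter> (D \<union> (S - S')) = {}" "S' \<inter> (D \<union> (S - S')) = {}"
      using sD(1-7) P S' by auto
    show "p = b" if "b \<in> B - P" "p \<in> X" "below p b" for b p
      using that sD(8) by blast
    show "s = t" if "s \<in> S'" "t \<in> S'" "below s t" for s t
      using anti[OF that] .
    show "\<exists>s\<in>S'. below s d" if "d \<in> D \<union> (S - S')" for d
      using dsub[OF that] .
  next
    fix a b s t
    assume "free (B - P) (S \<union> D \<union> P) f' (quad X a b)"
      "s \<in> quad X a b \<inter> S'" "t \<in> quad X a b \<inter> S'"
    then show "s = t" by (rule one)
  next
    fix a b
    assume "free (B - P) (S \<union> D \<union> P) f' (quad X a b)"
    then show "card (quad X a b \<inter> (D \<union> (S - S'))) \<le>
      card {p \<in> quad X a b \<inter> (B - P). \<forall>s\<in>quad X a b \<inter> S'. \<not> below p s}"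
      by (rule shadow)
  qed
qed

section \<open>Colouring blanks\<close>

text \<open>The case \<open>p = q\<close> colours a single blank, both of whose neighbours have the same colour.\<close>
lemma balanced_promote_pair:
  assumes st: "balanced X B S D f"
    and pB: "p \<in> B" and qB: "q \<in> B" and pq: "x p \<le> x q"
    and l: "left_colour S f p l" and r: "right_colour S f q r" and lr: "p = q \<longleftrightarrow> l = r"
    and gap: "\<And>t. t \<in> S \<Longrightarrow> x p < x t \<Longrightarrow> x t < x q \<Longrightarrow> y q < y t \<Longrightarrow> y t < y p \<Longrightarrow> False"
    and two: "\<And>u v. v \<in> {p, q} \<Longrightarrow> u \<in> S \<Longrightarrow> below v u \<Longrightarrow> \<exists>w\<in>B. w \<noteq> v \<and> below w u"
  obtains S' D' f' where "balanced X (B - {p, q}) S' D' f'" "S' \<union> D' = S \<union> D \<union> {p, q}"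
    "\<And>i. i \<in> S \<union> D \<Longrightarrow> f' i = f i"
proof -
  note sD = balancedD[OF st]
  \<comment> \<open>Each blank opposes its outer neighbour. By \<open>lr\<close> this gives two
    different colours if \<open>p \<noteq> q\<close> and is consistent if
    \<open>p = q\<close>.\<close>
  define f' where "f' = f(p := \<not> l, q := \<not> r)"
  define S' where "S' = {s \<in> S. \<forall>v\<in>{p, q}. \<not> below v s} \<union> {p, q}"
  have PB: "{p, q} \<subseteq> B" using pB qB by auto
  have pqX: "p \<in> X" "q \<in> X" "p \<in> I" "q \<in> I" using pB qB sD(1,2) by auto
  have SI: "t \<in> X" "t \<in> I" if "t \<in> S" for t using that sD(1,3) by auto
  have "p \<noteq> q \<Longrightarrow> \<not> below p q" "p \<noteq> q \<Longrightarrow> \<not> below q p"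
    using sD(8)[OF pB pqX(2)] sD(8)[OF qB pqX(1)] by blast+
  then have ypq: "y q \<le> y p"
    using incomparable[OF pqX(3,4)] pq by fastforce
  have f': "f' i = f i" if "i \<in> S \<union> D" for i
    using that pB qB sD(5,6) by (auto simp: f'_def)
  have fpq: "f' p = (\<not> l)" "f' q = (\<not> r)" using lr by (auto simp: f'_def)
  have one: "s = t"
    if fr: "free (B - {p, q}) (S \<union> D \<union> {p, q}) f' (quad X a b)"
      and s: "s \<in> quad X a b \<inter> S'" and t: "t \<in> quad X a b \<inter> S'" for a b s t
  proof -
    let ?W = "quad X a b"
    have mono: "f' i = f' j" if "i \<in> ?W" "j \<in> ?W" "i \<in> S \<union> {p, q}" "j \<in> S \<union> {p, q}" for i j
      using that fr unfolding free_def bichromatic_def by blast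
    have both: "p = q" if "p \<in> ?W" "q \<in> ?W"
      using mono[OF that] fpq lr by auto
    \<comment> \<open>By \<open>gap\<close>, a surviving \<open>u\<close> lies left of
      \<open>p\<close> or right of \<open>q\<close>. The quadrant then contains that blank together
      with a point \<open>v\<close> of \<open>S\<close>, on the way from \<open>u\<close> to the
      blank, of the colour which the blank opposes.\<close>
    have kept: False if W: "p \<in> ?W \<or> q \<in> ?W" and u: "u \<in> ?W" "u \<in> S" "\<not> below p u" "\<not> below q u" for u
    proof -
      have inc: "x u < x v \<and> y v < y u \<or> x v < x u \<and> y u < y v" if "v \<in> {p, q}" for v
      proof -
        have "\<not> below u v" using that sD(8)[OF _ SI(1)[OF u(2)], of v] PB u sD(5) by auto
        then show ?thesis using incomparable[of u v] that u pqX SI by auto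
      qed
      consider "x u < x p" | "y u < y q"
        using inc[of p] inc[of q] gap[OF u(2)] by fastforce
      then show False
      proof cases
        case 1
        then have "y p < y u" using inc[of p] by auto
        then have pW: "p \<in> ?W" using W u(1) pq pqX by (auto simp: quad_def)
        obtain v where v: "v \<in> S" "x u \<le> x v" "x v < x p" "f v = l"
          using l 1 u unfolding left_colour_def by blast
        have "y v \<le> y u"
          using v(2) sD(9)[OF u(2) v(1)] by (cases "y v \<le> y u") (auto simp: below_def)
        then have "v \<in> ?W" using v pW u(1) SI by (auto simp: quad_def)
        then show False using mono[OF pW, of v] v fpq f'[of v] by auto
      next
        case 2
        then have "x q < x u" using inc[of q] by auto
        then have qW: "q \<in> ?W" using W u(1) ypq pqX by (auto simp: quad_def)
        obtain v where v: "v \<in> S" "y u \<le> y v" "y v < y q" "f v = r"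
          using r 2 u unfolding right_colour_def by blast
        have "x v \<le> x u"
          using v(2) sD(9)[OF u(2) v(1)] by (cases "x v \<le> x u") (auto simp: below_def)
        then have "v \<in> ?W" using v qW u(1) SI by (auto simp: quad_def)
        then show False using mono[OF qW, of v] v fpq f'[of v] by auto
      qed
    qed
    show ?thesis
    proof (cases "p \<in> ?W \<or> q \<in> ?W")
      case True
      then show ?thesis using s t both kept[OF True] unfolding S'_def by blast
    next
      case False
      then have "s \<in> S" "t \<in> S" using s t by (auto simp: S'_def)
      moreover have "free B (S \<union> D) f ?W" using free_recolour[OF fr PB f'] .
      ultimately show ?thesis using sD(11) s t by blast
    qed
  qed
  have "balanced X (B - {p, q}) S' (D \<union> (S - S')) f'"
    using balanced_promote[OF st PB S'_def f' one two] .
  moreover have "S' \<union> (D \<union> (S - S')) = S \<union> D \<union> {p, q}" by (auto simp: S'_def)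
  ultimately show ?thesis using that f' by blast
qed

section \<open>Choosing which of six blanks to colour\<close>

lemma obtain_sorted_six:
  assumes "A \<subseteq> I" "6 \<le> card A"
  obtains p :: "nat \<Rightarrow> 'i" where "\<And>i. i < 6 \<Longrightarrow> p i \<in> A"
    "\<And>i j. i < j \<Longrightarrow> j < 6 \<Longrightarrow> x (p i) < x (p j)"
proof -
  let ?L = "sorted_list_of_set (x ` A)"
  have fin: "finite (x ` A)" using finite_sub assms(1) by blast
  have len: "6 \<le> length ?L"
    using assms card_image[OF inj_on_subset[OF inj_x assms(1)]] by simp
  have "\<exists>a. a \<in> A \<and> x a = ?L ! i" if "i < 6" for i
    using that len fin nth_mem[of i ?L] by auto
  then obtain p where p: "\<And>i. i < 6 \<Longrightarrow> p i \<in> A \<and> x (p i) = ?L ! i" by metis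
  show ?thesis
  proof (rule that)
    show "x (p i) < x (p j)" if "i < j" "j < 6" for i j
      using that p[of i] p[of j] len sorted_wrt_nth_less[OF strict_sorted_list_of_set] by force
  qed (use p in auto)
qed

text \<open>If \<open>l i = r i\<close> for some index, take \<open>j = i\<close>. Otherwise
  \<open>r\<close> is the negation of \<open>l\<close> on all three, and two indices
  \<open>i < j\<close> with \<open>l i = l j\<close> exist by the pigeonhole principle.\<close>

lemma select_colours:
  fixes l r :: "nat \<Rightarrow> bool"
  obtains i j where "i \<in> {1, 2, 3}" "j \<in> {1, 2, 3}" "i \<le> j" "i = j \<longleftrightarrow> l i = r j"
proof -
  have "\<exists>i\<in>{1, 2, 3}. \<exists>j\<in>{1, 2, 3}. i \<le> j \<and> (i = j \<longleftrightarrow> l i = r j)"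
    by (simp del: One_nat_def) blast
  then show ?thesis using that by blast
qed

text \<open>The six blanks form an antichain, with \<open>y\<close> falling as \<open>x\<close>
  rises. Only the inner four are candidates; the outer two serve as second blanks below points of
  \<open>S\<close> outside the quadrant. The choice depends on the position of the only point of
  \<open>S\<close> inside, if there is one.\<close>

lemma balanced_promote_six:
  assumes st: "balanced X B S D f"
    and fr: "free B (S \<union> D) f (quad X a b)"
    and six: "6 \<le> card (quad X a b \<inter> B)"
  obtains P S' D' f' where "P \<noteq> {}" "P \<subseteq> B" "balanced X (B - P) S' D' f'"
    "S' \<union> D' = S \<union> D \<union> P" "\<And>i. i \<in> S \<union> D \<Longrightarrow> f' i = f i"
proof -
  note result = that
  note sD = balancedD[OF st]
  let ?Q = "quad X a b"
  have QI: "?Q \<inter> B \<subseteq> I" and SI: "S \<subseteq> I" using sD(1-3) by auto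
  obtain p :: "nat \<Rightarrow> 'i" where p: "\<And>i. i < 6 \<Longrightarrow> p i \<in> ?Q \<inter> B"
    and px: "\<And>i j. i < j \<Longrightarrow> j < 6 \<Longrightarrow> x (p i) < x (p j)"
    by (rule obtain_sorted_six[OF QI six]) blast
  have pB: "p i \<in> B" "p i \<in> X" "p i \<in> I" "x (p i) < a" "y (p i) < b" if "i < 6" for i
    using p[OF that] sD(1) by (auto simp: quad_def)
  have py: "y (p j) < y (p i)" if "i < j" "j < 6" for i j
  proof -
    have ij: "i < 6" "x (p i) < x (p j)" using px[OF that] that by auto
    then have "\<not> below (p i) (p j)"
      using sD(8)[OF pB(1)[OF that(2)] pB(2)[OF ij(1)]] by auto
    then show ?thesis using ij by (auto simp: below_def)
  qed
  have "\<exists>l. \<forall>i. left_colour S f (p i) (l i)" "\<exists>r. \<forall>i. right_colour S f (p i) (r i)"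
    using left_colour_ex[OF SI] right_colour_ex[OF SI] by (intro choice; blast)+
  then obtain l r where l: "\<And>i. left_colour S f (p i) (l i)"
    and r: "\<And>i. right_colour S f (p i) (r i)"
    by blast
  \<comment> \<open>a point outside the quadrant above some \<open>p i\<close> is also above the first or the last of the six\<close>
  have out: "\<exists>w\<in>B. w \<noteq> p i \<and> below w u"
    if u: "u \<in> S" "u \<notin> ?Q" "below (p i) u" "i \<in> {1..4}" for u i
  proof -
    have "u \<in> X" using u(1) sD(3) by auto
    then consider "a \<le> x u" | "b \<le> y u"
      using u(2) by (force simp: quad_def)
    then show ?thesis
    proof cases
      case 1
      then have "below (p 5) u"
        using pB(4)[of 5] py[of i 5] u(3,4) by (auto simp: below_def)
      moreover have "p 5 \<noteq> p i" using px[of i 5] u(4) by auto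
      ultimately show ?thesis using pB(1)[of 5] by auto
    next
      case 2
      then have "below (p 0) u"
        using pB(5)[of 0] px[of 0 i] u(3,4) by (auto simp: below_def)
      moreover have "p 0 \<noteq> p i" using px[of 0 i] u(4) by auto
      ultimately show ?thesis using pB(1)[of 0] by auto
    qed
  qed
  \<comment> \<open>By \<open>out\<close>, only points of \<open>S\<close> inside the quadrant need
    checking; a point between \<open>p i\<close> and \<open>p j\<close> lies inside anyway.\<close>
  have select: thesis
    if ij: "i \<in> {1..4}" "j \<in> {1..4}" "i \<le> j"
      and col: "left_colour S f (p i) l" "right_colour S f (p j) r" "i = j \<longleftrightarrow> l = r"
      and gap: "\<And>t. t \<in> S \<inter> ?Q \<Longrightarrow> x (p i) < x t \<Longrightarrow> x t < x (p j) \<Longrightarrow>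
        y (p j) < y t \<Longrightarrow> y t < y (p i) \<Longrightarrow> False"
      and ins: "\<And>u k. u \<in> S \<inter> ?Q \<Longrightarrow> k \<in> {i, j} \<Longrightarrow> below (p k) u \<Longrightarrow>
        \<exists>w\<in>B. w \<noteq> p k \<and> below w u" for i j l r
  proof (rule balanced_promote_pair[OF st _ _ _ col(1,2)])
    have ij6: "i < 6" "j < 6" using ij by auto
    show "p i \<in> B" "p j \<in> B" using pB ij6 by auto
    show "x (p i) \<le> x (p j)" using px[of i j] ij ij6 by (cases "i = j") auto
    have "p i = p j \<longleftrightarrow> i = j" using px[of i j] ij ij6 by (cases "i = j") auto
    then show "p i = p j \<longleftrightarrow> l = r" using col(3) by simp
    show False if "t \<in> S" "x (p i) < x t" "x t < x (p j)" "y (p j) < y t" "y t < y (p i)" for t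
      using gap[of t] that pB(4)[OF ij6(2)] pB(5)[OF ij6(1)] sD(3) by (auto simp: quad_def)
    show "\<exists>w\<in>B. w \<noteq> v \<and> below w u" if v: "v \<in> {p i, p j}" "u \<in> S" "below v u" for u v
    proof -
      obtain k where k: "k \<in> {i, j}" "v = p k" using v(1) by auto
      then show ?thesis using out[of u k] ins[of u k] v ij by (cases "u \<in> ?Q") auto
    qed
  next
    fix S' D' f'
    assume "balanced X (B - {p i, p j}) S' D' f'" "S' \<union> D' = S \<union> D \<union> {p i, p j}"
      "\<And>i. i \<in> S \<union> D \<Longrightarrow> f' i = f i"
    then show thesis using result[of "{p i, p j}"] pB(1)[of i] pB(1)[of j] ij by auto
  qed
  show thesis
  proof (cases "S \<inter> ?Q = {}")
    case True
    obtain i j where ij: "i \<in> {1, 2, 3}" "j \<in> {1, 2, 3}" "i \<le> j" "i = j \<longleftrightarrow> l i = r j"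
      by (rule select_colours[of l r])
    then have "i \<in> {1..4}" "j \<in> {1..4}" by auto
    then show thesis by (rule select[OF _ _ ij(3) l r ij(4)]) (use True in auto)
  next
    case False
    then obtain s where s: "s \<in> S" "s \<in> ?Q" by auto
    then have only: "t = s" if "t \<in> S \<inter> ?Q" for t
      using sD(11)[OF fr] that by blast
    have sX: "s \<in> X" "s \<in> I" using s sD(1,3) by auto
    have inc: "below (p i) s \<or> x (p i) < x s \<and> y s < y (p i) \<or> x s < x (p i) \<and> y (p i) < y s"
      if "i < 6" for i
    proof -
      have "\<not> below s (p i)" using sD(8)[OF pB(1)[OF that] sX(1)] pB(1)[OF that] s sD(5) by auto
      then show ?thesis using incomparable[OF pB(3)[OF that] sX(2)] by auto
    qed
    \<comment> \<open>Two of the inner blanks lie left of \<open>s\<close>, or two right of it, or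
      two below it.\<close>
    consider "x (p 2) < x s" "y s < y (p 2)" | "x s < x (p 3)" "y (p 3) < y s"
      | "below (p 2) s" "below (p 3) s"
      using inc[of 2] inc[of 3] px[of 2 3] py[of 2 3] by fastforce
    then show thesis
    proof cases
      case 1
      then have 11: "x (p 1) < x s" "y s < y (p 1)" using px[of 1 2] py[of 1 2] by auto
      have nb: "\<not> below (p 1) s" "\<not> below (p 2) s" using 1 11 by (auto simp: below_def)
      \<comment> \<open>A point of \<open>S\<close> with \<open>y\<close> strictly between
        \<open>s\<close> and \<open>p i\<close> would lie in the quadrant, where \<open>s\<close> is
        alone. So \<open>s\<close> is the right neighbour of both \<open>p 1\<close> and
        \<open>p 2\<close>.\<close>
      have rc: "right_colour S f (p i) (f s)" if i: "i \<in> {1, 2}" for i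
        unfolding right_colour_def
      proof (intro ballI impI)
        fix t assume t: "t \<in> S" "y t < y (p i)"
        have "y t \<le> y s"
        proof (rule ccontr)
          assume ts: "\<not> y t \<le> y s"
          then have "x t < x s"
            using sD(9)[OF s(1) t(1)] by (cases "x s \<le> x t") (auto simp: below_def)
          then have "t \<in> S \<inter> ?Q"
            using t s sD(3) pB(5)[of i] i by (auto simp: quad_def)
          then show False using only ts by auto
        qed
        then show "\<exists>v\<in>S. y t \<le> y v \<and> y v < y (p i) \<and> f v = f s"
          using s 1 11 i by (intro bexI[of _ s]) auto
      qed
      \<comment> \<open>If both neighbours of \<open>p 1\<close> agree in colour, it is coloured
        alone, otherwise together with \<open>p 2\<close>.\<close>
      show thesis
      proof (cases "l 1 = f s")
        case True
        show thesis by (rule select[OF _ _ _ l[of 1] rc[of 1]]) (use True only nb in auto)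
      next
        case False
        show thesis
          by (rule select[OF _ _ _ l[of 1] rc[of 2]]) (use False only nb 1 in auto)
      qed
    next
      case 2
      then have 21: "x s < x (p 4)" "y (p 4) < y s" using px[of 3 4] py[of 3 4] by auto
      have nb: "\<not> below (p 3) s" "\<not> below (p 4) s" using 2 21 by (auto simp: below_def)
      \<comment> \<open>The mirror image: \<open>s\<close> is the left neighbour of both
        \<open>p 3\<close> and \<open>p 4\<close>.\<close>
      have lc: "left_colour S f (p i) (f s)" if i: "i \<in> {3, 4}" for i
        unfolding left_colour_def
      proof (intro ballI impI)
        fix t assume t: "t \<in> S" "x t < x (p i)"
        have "x t \<le> x s"
        proof (rule ccontr)
          assume ts: "\<not> x t \<le> x s"
          then have "y t < y s"
            using sD(9)[OF s(1) t(1)] by (cases "y s \<le> y t") (auto simp: below_def)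
          then have "t \<in> S \<inter> ?Q"
            using t s sD(3) pB(4)[of i] i by (auto simp: quad_def)
          then show False using only ts by auto
        qed
        then show "\<exists>v\<in>S. x t \<le> x v \<and> x v < x (p i) \<and> f v = f s"
          using s 2 21 i by (intro bexI[of _ s]) auto
      qed
      show thesis
      proof (cases "r 4 = f s")
        case True
        show thesis by (rule select[OF _ _ _ lc[of 4] r[of 4]]) (use True only nb in auto)
      next
        case False
        show thesis
          by (rule select[OF _ _ _ lc[of 3] r[of 4]]) (use False only nb 2 in auto)
      qed
    next
      case 3
      obtain i j where ij: "i \<in> {1, 2, 3}" "j \<in> {1, 2, 3}" "i \<le> j" "i = j \<longleftrightarrow> l i = r j"
        by (rule select_colours[of l r])
      then have ij': "i \<in> {1..4}" "j \<in> {1..4}" by auto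
      have ne: "p 2 \<noteq> p 1" "p 3 \<noteq> p 2" "p 3 \<noteq> p 1"
        using px[of 1 2] px[of 2 3] px[of 1 3] by auto
      \<comment> \<open>Whichever candidate is coloured, \<open>p 2\<close> or \<open>p 3\<close> is
        a different blank below \<open>s\<close>.\<close>
      have ins: "\<exists>w\<in>B. w \<noteq> p k \<and> below w s" if "k \<in> {i, j}" for k
      proof -
        have "k \<in> {1, 2, 3}" using that ij by auto
        then have "p (if k = 2 then 3 else 2) \<noteq> p k" using ne by auto
        moreover have "p (if k = 2 then 3 else 2) \<in> B" "below (p (if k = 2 then 3 else 2)) s"
          using 3 pB(1) by auto
        ultimately show ?thesis by blast
      qed
      \<comment> \<open>Only \<open>p 1\<close> among the candidates can fail to be below
        \<open>s\<close>, so \<open>s\<close> is not strictly between two of them.\<close>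
      have gap: False if "x (p i) < x s" "x s < x (p j)" "y (p j) < y s" "y s < y (p i)"
      proof -
        have "\<not> below (p i) s" "\<not> below (p j) s" using that by (auto simp: below_def)
        then have "i = 1" "j = 1" using 3 ij by auto
        then show False using that by auto
      qed
      show thesis
        by (rule select[OF ij'(1,2) ij(3) l r ij(4)]) (use only gap ins in blast)+
    qed
  qed
qed

section \<open>Arrival of points\<close>

text \<open>The universally quantified \<open>g\<close> expresses that the colours of the blanks are still free.\<close>
definition extendable :: "'i list \<Rightarrow> 'i set \<Rightarrow> 'i set \<Rightarrow> ('i \<Rightarrow> bool) \<Rightarrow> bool" where
  "extendable zs B C f \<longleftrightarrow> (\<forall>g. \<exists>c. (\<forall>i\<in>B. c i = g i) \<and> (\<forall>i\<in>C. c i = f i) \<and>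
     (\<forall>a b. \<not> quad (set zs) a b \<subseteq> B \<union> C \<longrightarrow> bichromatic c (quad (set zs) a b)) \<and>
     (\<forall>k a b. k < length zs \<longrightarrow> 12 \<le> card (quad (set (take k zs)) a b) \<longrightarrow>
        bichromatic c (quad (set (take k zs)) a b)))"

definition few_blanks :: "'i set \<Rightarrow> 'i set \<Rightarrow> 'i set \<Rightarrow> ('i \<Rightarrow> bool) \<Rightarrow> bool" where
  "few_blanks X B C f \<longleftrightarrow> (\<forall>a b. free B C f (quad X a b) \<longrightarrow> card (quad X a b \<inter> B) \<le> 5)"

text \<open>The colours of the promoted blanks are one of the prescriptions \<open>g\<close> that
  were already allowed.\<close>

lemma extendable_promote:
  assumes "extendable zs B C f" "P \<subseteq> B" "C' = C \<union> P" "B \<inter> C = {}"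
    "\<And>i. i \<in> C \<Longrightarrow> f' i = f i"
  shows "extendable zs (B - P) C' f'"
  unfolding extendable_def
proof (intro allI)
  fix g
  have BC: "B - P \<union> C' = B \<union> C" using assms by auto
  obtain c where c: "\<forall>i\<in>B. c i = (if i \<in> P then f' i else g i)" "\<forall>i\<in>C. c i = f i"
    "\<forall>a b. \<not> quad (set zs) a b \<subseteq> B \<union> C \<longrightarrow> bichromatic c (quad (set zs) a b)"
    "\<forall>k a b. k < length zs \<longrightarrow> 12 \<le> card (quad (set (take k zs)) a b) \<longrightarrow>
        bichromatic c (quad (set (take k zs)) a b)"
    using spec[OF assms(1)[unfolded extendable_def], of "\<lambda>i. if i \<in> P then f' i else g i"]
    by blast
  show "\<exists>c. (\<forall>i\<in>B - P. c i = g i) \<and> (\<forall>i\<in>C'. c i = f' i) \<and>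
     (\<forall>a b. \<not> quad (set zs) a b \<subseteq> B - P \<union> C' \<longrightarrow> bichromatic c (quad (set zs) a b)) \<and>
     (\<forall>k a b. k < length zs \<longrightarrow> 12 \<le> card (quad (set (take k zs)) a b) \<longrightarrow>
        bichromatic c (quad (set (take k zs)) a b))"
    unfolding BC using c(1,2) assms(2,3,5) by (intro exI[of _ c] conjI c(3,4)) auto
qed

text \<open>Promotion is repeated while some free quadrant has six blanks; each round shrinks the
  finite set \<open>B\<close>.\<close>

lemma reduce_blanks:
  assumes "balanced (set zs) B S D f" "extendable zs B (S \<union> D) f"
  shows "\<exists>B S D f. balanced (set zs) B S D f \<and> extendable zs B (S \<union> D) f \<and>
    few_blanks (set zs) B (S \<union> D) f"
  using assms
proof (induction "card B" arbitrary: B S D f rule: less_induct)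
  case less
  note sD = balancedD[OF less.prems(1)]
  show ?case
  proof (cases "few_blanks (set zs) B (S \<union> D) f")
    case True
    then show ?thesis using less.prems by blast
  next
    case False
    then obtain a b where "free B (S \<union> D) f (quad (set zs) a b)"
      "6 \<le> card (quad (set zs) a b \<inter> B)"
      unfolding few_blanks_def by (auto simp: not_le Suc_le_eq)
    then obtain P S' D' f' where P: "P \<noteq> {}" "P \<subseteq> B"
      and st: "balanced (set zs) (B - P) S' D' f'"
      and C: "S' \<union> D' = S \<union> D \<union> P" and f': "\<And>i. i \<in> S \<union> D \<Longrightarrow> f' i = f i"
      using balanced_promote_six[OF less.prems(1)] by metis
    have "extendable zs (B - P) (S' \<union> D') f'"
      using extendable_promote[OF less.prems(2) P(2) C _ f'] sD(5,6) by auto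
    moreover have "card (B - P) < card B"
      using P finite_subset[OF sD(2)] by (intro psubset_card_mono) auto
    ultimately show ?thesis using less.hyps st by blast
  qed
qed

lemma card_free_le:
  assumes st: "balanced X B S D f" and few: "few_blanks X B (S \<union> D) f"
    and fr: "free B (S \<union> D) f (quad X a b)"
  shows "card (quad X a b) \<le> 11"
proof -
  note sD = balancedD[OF st]
  let ?W = "quad X a b"
  have fin: "finite ?W" using finite_sub[OF sD(1)] by (simp add: quad_def)
  have B: "card (?W \<inter> B) \<le> 5" using few fr by (simp add: few_blanks_def)
  have S: "card (?W \<inter> S) \<le> 1"
    using sD(11)[OF fr] fin by (subst card_le_Suc0_iff_eq[folded One_nat_def]) auto
  have "card (?W \<inter> D) \<le> card {p \<in> ?W \<inter> B. \<forall>s\<in>?W \<inter> S. \<not> below p s}"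
    using sD(12)[OF fr] .
  also have "\<dots> \<le> card (?W \<inter> B)" using fin by (intro card_mono) auto
  finally have D: "card (?W \<inter> D) \<le> 5" using B by simp
  have "?W = ?W \<inter> B \<union> (?W \<inter> S \<union> ?W \<inter> D)" using fr by (auto simp: free_def)
  then have "card ?W \<le> card (?W \<inter> B) + (card (?W \<inter> S) + card (?W \<inter> D))"
    by (metis card_Un_le add_left_mono order_trans)
  then show ?thesis using B S D by simp
qed

text \<open>Twelve points are too many for a free quadrant, so either both fixed colours occur in it
  or it has a point outside \<open>B\<close>, \<open>S\<close> and \<open>D\<close>, where
  \<open>star\<close> applies.\<close>

lemma bichromatic_of_large:
  assumes st: "balanced X B S D f" and few: "few_blanks X B (S \<union> D) f"
    and c: "\<forall>i\<in>S \<union> D. c i = f i"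
    and star: "\<not> quad X a b \<subseteq> B \<union> (S \<union> D) \<Longrightarrow> bichromatic c (quad X a b)"
    and large: "12 \<le> card (quad X a b)"
  shows "bichromatic c (quad X a b)"
proof (cases "quad X a b \<subseteq> B \<union> (S \<union> D)")
  case True
  have "\<not> free B (S \<union> D) f (quad X a b)" using card_free_le[OF st few] large by fastforce
  then have "bichromatic f (quad X a b \<inter> (S \<union> D))" using True by (simp add: free_def)
  then show ?thesis using c unfolding bichromatic_def by (metis IntE)
qed (use star in auto)

lemma quad_insert:
  "quad (insert r X) a b = (if x r < a \<and> y r < b then insert r (quad X a b) else quad X a b)"
  by (auto simp: quad_def)

text \<open>The common part of both kinds of arrival. In \<open>cover\<close>, \<open>h\<close> is
  what the old blanks are told so that the new ones get \<open>g\<close>, and \<open>k c\<close> is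
  the colour of \<open>r\<close>, which may depend on theirs.\<close>

lemma extendable_snoc:
  assumes st: "balanced (set zs) B S D f" and few: "few_blanks (set zs) B (S \<union> D) f"
    and ext: "extendable zs B (S \<union> D) f" and r: "r \<notin> set zs"
    and cover: "\<And>g. \<exists>h k. \<forall>c. (\<forall>i\<in>B. c i = h i) \<longrightarrow>
      (\<forall>i\<in>B'. (c(r := k c)) i = g i) \<and>
      (\<forall>a b. quad (set zs) a b \<subseteq> B \<union> (S \<union> D) \<longrightarrow>
         \<not> quad (insert r (set zs)) a b \<subseteq> B' \<union> (S \<union> D) \<longrightarrow>
         bichromatic (c(r := k c)) (quad (insert r (set zs)) a b))"
  shows "extendable (zs @ [r]) B' (S \<union> D) f"
  unfolding extendable_def
proof (intro allI)
  fix g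
  note sD = balancedD[OF st]
  obtain h k where hk: "\<forall>c. (\<forall>i\<in>B. c i = h i) \<longrightarrow> (\<forall>i\<in>B'. (c(r := k c)) i = g i) \<and>
      (\<forall>a b. quad (set zs) a b \<subseteq> B \<union> (S \<union> D) \<longrightarrow>
         \<not> quad (insert r (set zs)) a b \<subseteq> B' \<union> (S \<union> D) \<longrightarrow>
         bichromatic (c(r := k c)) (quad (insert r (set zs)) a b))"
    using cover[of g] by (elim exE)
  obtain c where c: "\<forall>i\<in>B. c i = h i" "\<forall>i\<in>S \<union> D. c i = f i"
    "\<And>a b. \<not> quad (set zs) a b \<subseteq> B \<union> (S \<union> D) \<Longrightarrow> bichromatic c (quad (set zs) a b)"
    "\<And>k a b. k < length zs \<Longrightarrow> 12 \<le> card (quad (set (take k zs)) a b) \<Longrightarrow>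
        bichromatic c (quad (set (take k zs)) a b)"
    using spec[OF ext[unfolded extendable_def], of h] by blast
  let ?c = "c(r := k c)"
  note hkc = mp[OF spec[OF hk, of c] c(1)]
  have same: "bichromatic ?c (quad Y a b) = bichromatic c (quad Y a b)" if "Y \<subseteq> set zs" for Y a b
    using that r by (intro bichromatic_cong) (auto simp: quad_def)
  have old: "bichromatic ?c (quad (set (take k (zs @ [r]))) a b)"
    if "k < length (zs @ [r])" "12 \<le> card (quad (set (take k (zs @ [r]))) a b)" for k a b
  proof (cases "k = length zs")
    \<comment> \<open>The moment just before \<open>r\<close> arrives is not covered by
      \<open>ext\<close>, which has \<open>k < length zs\<close>; the bound on free quadrants
      settles it.\<close>
    case True
    then show ?thesis
      using bichromatic_of_large[OF st few c(2) c(3), of a b] that(2) same[of "set zs"] by simp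
  next
    case False
    then have "k < length zs" using that by simp
    then show ?thesis using c(4)[of k a b] that(2) same[OF set_take_subset] by simp
  qed
  have new: "bichromatic ?c (quad (set (zs @ [r])) a b)"
    if "\<not> quad (set (zs @ [r])) a b \<subseteq> B' \<union> (S \<union> D)" for a b
  proof (cases "quad (set zs) a b \<subseteq> B \<union> (S \<union> D)")
    case True
    then show ?thesis using conjunct2[OF hkc, rule_format, of a b] that by simp
  next
    case False
    then have "bichromatic ?c (quad (set zs) a b)" using c(3) same[of "set zs"] by simp
    moreover have "quad (set zs) a b \<subseteq> quad (set (zs @ [r])) a b" by (auto simp: quad_def)
    ultimately show ?thesis unfolding bichromatic_def by blast
  qed
  have "\<forall>i\<in>S \<union> D. ?c i = f i" using c(2) r sD(3,4) by auto
  then show "\<exists>c. (\<forall>i\<in>B'. c i = g i) \<and> (\<forall>i\<in>S \<union> D. c i = f i) \<and>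
     (\<forall>a b. \<not> quad (set (zs @ [r])) a b \<subseteq> B' \<union> (S \<union> D) \<longrightarrow>
        bichromatic c (quad (set (zs @ [r])) a b)) \<and>
     (\<forall>k a b. k < length (zs @ [r]) \<longrightarrow> 12 \<le> card (quad (set (take k (zs @ [r]))) a b) \<longrightarrow>
        bichromatic c (quad (set (take k (zs @ [r]))) a b))"
    using conjunct1[OF hkc] new old by (intro exI[of _ ?c] conjI) auto
qed

section \<open>The invariant under arrivals\<close>

text \<open>As \<open>r\<close> stays outside \<open>B\<close>, \<open>S\<close> and
  \<open>D\<close>, no free quadrant contains it and all counts are unchanged.\<close>

lemma balanced_insert_above:
  assumes st: "balanced X B S D f" and r: "r \<in> I" "r \<notin> X" and p: "p \<in> X" "below p r"
  shows "balanced (insert r X) B S D f"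
proof -
  note sD = balancedD[OF st]
  have rBC: "r \<notin> B \<union> (S \<union> D)" using sD(2-4) r by auto
  have eq: "quad (insert r X) a b = quad X a b" and fr: "free B (S \<union> D) f (quad X a b)"
    if "free B (S \<union> D) f (quad (insert r X) a b)" for a b
    using that rBC unfolding free_def by (auto simp: quad_insert split: if_splits)
  show ?thesis
    unfolding balanced_def
  proof (intro conjI allI impI ballI)
    show "insert r X \<subseteq> I" "B \<union> S \<union> D \<subseteq> insert r X" "B \<inter> S = {}" "B \<inter> D = {}" "S \<inter> D = {}"
      using sD(1-7) r by auto
    show "q = b" if q: "b \<in> B" "q \<in> insert r X" "below q b" for b q
    proof (cases "q = r")
      case True
      \<comment> \<open>A blank above \<open>r\<close> is above \<open>p\<close>, hence equal to
        \<open>p\<close> by minimality; then \<open>r\<close> and \<open>p\<close> would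
        coincide.\<close>
      then have "p = b" using sD(8)[OF q(1) p(1)] below_trans[OF p(2)] q(3) by simp
      then have "b \<noteq> r" "below b r" "below r b" using p r q True by auto
      then show ?thesis
        using inj_onD[OF inj_x, of b r] r q(1) sD(1,2) by (auto simp: below_def)
    qed (use q sD(8) in auto)
    show "s = t" if "s \<in> S" "t \<in> S" "below s t" for s t using sD(9)[OF that] .
    show "\<exists>s\<in>S. below s d" if "d \<in> D" for d using sD(10)[OF that] .
  next
    fix a b s t
    assume "free B (S \<union> D) f (quad (insert r X) a b)" "s \<in> quad (insert r X) a b \<inter> S"
      "t \<in> quad (insert r X) a b \<inter> S"
    then show "s = t" using sD(11)[OF fr] eq by auto
  next
    fix a b
    assume "free B (S \<union> D) f (quad (insert r X) a b)"
    then show "card (quad (insert r X) a b \<inter> D) \<le> card {p \<in> quad (insert r X) a b \<inter> B.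
        \<forall>s\<in>quad (insert r X) a b \<inter> S. \<not> below p s}"
      using sD(12)[OF fr] eq by simp
  qed
qed

text \<open>Blanks above \<open>r\<close> are dropped, but a quadrant that is still free contains
  none of them. So it loses no blank, and its points of \<open>S\<close> and \<open>D\<close> are
  the same.\<close>

lemma balanced_insert_minimal:
  assumes st: "balanced X B S D f" and r: "r \<in> I" "r \<notin> X"
    and min: "\<And>p. p \<in> X \<Longrightarrow> \<not> below p r"
    and B': "B' = insert r {b \<in> B. \<not> below r b}"
  shows "balanced (insert r X) B' S D f"
proof -
  note sD = balancedD[OF st]
  have rC: "r \<notin> S \<union> D" using sD(2-4) r by auto
  have eq: "quad (insert r X) a b \<inter> S = quad X a b \<inter> S"
    "quad (insert r X) a b \<inter> D = quad X a b \<inter> D" for a b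
    using rC by (auto simp: quad_insert)
  have fr: "free B (S \<union> D) f (quad X a b)"
    and sub: "quad X a b \<inter> B \<subseteq> quad (insert r X) a b \<inter> B'"
    if f: "free B' (S \<union> D) f (quad (insert r X) a b)" for a b
  proof -
    have q: "quad (insert r X) a b \<inter> (S \<union> D) = quad X a b \<inter> (S \<union> D)"
      using eq by (simp add: Int_Un_distrib)
    have sub': "quad X a b \<subseteq> quad (insert r X) a b" by (auto simp: quad_def)
    have "r \<notin> quad X a b" using r by (simp add: quad_def)
    then show "free B (S \<union> D) f (quad X a b)"
      using f q sub' B' unfolding free_def by auto
    show "quad X a b \<inter> B \<subseteq> quad (insert r X) a b \<inter> B'"
      using f sub' sD(5,6) unfolding free_def by blast
  qed
  show ?thesis
    unfolding balanced_def
  proof (intro conjI allI impI ballI)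
    show "insert r X \<subseteq> I" "B' \<union> S \<union> D \<subseteq> insert r X" "B' \<inter> S = {}" "B' \<inter> D = {}" "S \<inter> D = {}"
      using sD(1-7) r rC B' by auto
    show "q = b" if "b \<in> B'" "q \<in> insert r X" "below q b" for b q
      using that B' min sD(8)[of b q] by auto
    show "s = t" if "s \<in> S" "t \<in> S" "below s t" for s t using sD(9)[OF that] .
    show "\<exists>s\<in>S. below s d" if "d \<in> D" for d using sD(10)[OF that] .
  next
    fix a b s t
    assume "free B' (S \<union> D) f (quad (insert r X) a b)" "s \<in> quad (insert r X) a b \<inter> S"
      "t \<in> quad (insert r X) a b \<inter> S"
    then show "s = t" using sD(11)[OF fr] eq by auto
  next
    fix a b
    assume f: "free B' (S \<union> D) f (quad (insert r X) a b)"
    have "finite (quad (insert r X) a b)"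
      using finite_sub[of "insert r X"] sD(1) r by (simp add: quad_def)
    then have "card {p \<in> quad X a b \<inter> B. \<forall>s\<in>quad X a b \<inter> S. \<not> below p s} \<le>
      card {p \<in> quad (insert r X) a b \<inter> B'. \<forall>s\<in>quad X a b \<inter> S. \<not> below p s}"
      using sub[OF f] by (intro card_mono) auto
    then show "card (quad (insert r X) a b \<inter> D) \<le> card {p \<in> quad (insert r X) a b \<inter> B'.
        \<forall>s\<in>quad (insert r X) a b \<inter> S. \<not> below p s}"
      using sD(12)[OF fr[OF f]] unfolding eq by simp
  qed
qed

lemma balanced_ex:
  assumes "distinct zs" "set zs \<subseteq> I"
  shows "\<exists>B S D f. balanced (set zs) B S D f \<and> extendable zs B (S \<union> D) f \<and>
    few_blanks (set zs) B (S \<union> D) f"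
  using assms
proof (induction zs rule: rev_induct)
  case Nil
  have "balanced (set []) {} {} {} (\<lambda>_. True)" by (simp add: balanced_def quad_def)
  moreover have "extendable [] {} ({} \<union> {}) (\<lambda>_. True)" by (simp add: extendable_def quad_def)
  ultimately show ?case by (rule reduce_blanks)
next
  case (snoc r zs)
  then obtain B S D f where st: "balanced (set zs) B S D f"
    and ext: "extendable zs B (S \<union> D) f" and few: "few_blanks (set zs) B (S \<union> D) f"
    by auto
  note sD = balancedD[OF st]
  have r: "r \<in> I" "r \<notin> set zs" using snoc.prems by auto
  show ?case
  proof (cases "\<exists>p\<in>set zs. below p r")
    case True
    then obtain p where p: "p \<in> set zs" "below p r" by auto
    \<comment> \<open>Every quadrant containing \<open>r\<close> contains \<open>p\<close>, and
      \<open>r\<close> takes the opposite colour.\<close>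
    have "extendable (zs @ [r]) B (S \<union> D) f"
    proof (rule extendable_snoc[OF st few ext r(2)])
      fix g
      have "bichromatic (c(r := \<not> c p)) (quad (insert r (set zs)) a b)"
        if "quad (set zs) a b \<subseteq> B \<union> (S \<union> D)"
          "\<not> quad (insert r (set zs)) a b \<subseteq> B \<union> (S \<union> D)" for c a b
      proof (rule bichromaticI)
        show rQ: "r \<in> quad (insert r (set zs)) a b"
          using that by (auto simp: quad_insert split: if_splits)
        show "p \<in> quad (insert r (set zs)) a b" using quad_down[OF rQ p(2)] p by auto
        show "(c(r := \<not> c p)) r \<noteq> (c(r := \<not> c p)) p" using p r by auto
      qed
      moreover have "r \<notin> B" using r sD(2) by auto
      ultimately show "\<exists>h k. \<forall>c. (\<forall>i\<in>B. c i = h i) \<longrightarrow> (\<forall>i\<in>B. (c(r := k c)) i = g i) \<and>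
        (\<forall>a b. quad (set zs) a b \<subseteq> B \<union> (S \<union> D) \<longrightarrow>
          \<not> quad (insert r (set zs)) a b \<subseteq> B \<union> (S \<union> D) \<longrightarrow>
          bichromatic (c(r := k c)) (quad (insert r (set zs)) a b))"
        by (intro exI[of _ g] exI[of _ "\<lambda>c. \<not> c p"]) auto
    qed
    moreover have "balanced (set (zs @ [r])) B S D f"
      using balanced_insert_above[OF st r p] by simp
    ultimately show ?thesis using reduce_blanks by blast
  next
    case False
    define B' where "B' = insert r {b \<in> B. \<not> below r b}"
    have "extendable (zs @ [r]) B' (S \<union> D) f"
    proof (rule extendable_snoc[OF st few ext r(2)])
      fix g
      \<comment> \<open>Blanks above \<open>r\<close> are tied to the opposite of the still
        arbitrary colour \<open>g r\<close>.\<close>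
      define h where "h = (\<lambda>i. if below r i then \<not> g r else g i)"
      have "bichromatic (c(r := g r)) (quad (insert r (set zs)) a b)"
        if c: "\<forall>i\<in>B. c i = h i" and q: "quad (set zs) a b \<subseteq> B \<union> (S \<union> D)"
          "\<not> quad (insert r (set zs)) a b \<subseteq> B' \<union> (S \<union> D)" for c a b
      proof -
        \<comment> \<open>The point \<open>e\<close> turns out to be a dropped blank above
          \<open>r\<close>.\<close>
        obtain e where e: "e \<in> quad (insert r (set zs)) a b" "e \<notin> B'" "e \<notin> S \<union> D"
          using q(2) by blast
        then have er: "e \<noteq> r" by (auto simp: B'_def)
        then have "e \<in> quad (set zs) a b" using e(1) by (auto simp: quad_def)
        then have eB: "e \<in> B" "below r e" using e q(1) by (auto simp: B'_def)
        show ?thesis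
        proof (rule bichromaticI)
          show "r \<in> quad (insert r (set zs)) a b" using quad_down[OF e(1) eB(2)] by auto
          show "(c(r := g r)) r \<noteq> (c(r := g r)) e" using er c eB by (auto simp: h_def)
        qed (rule e(1))
      qed
      moreover have "\<forall>i\<in>B'. (c(r := g r)) i = g i" if "\<forall>i\<in>B. c i = h i" for c
        using that by (auto simp: B'_def h_def)
      ultimately show "\<exists>h k. \<forall>c. (\<forall>i\<in>B. c i = h i) \<longrightarrow> (\<forall>i\<in>B'. (c(r := k c)) i = g i) \<and>
        (\<forall>a b. quad (set zs) a b \<subseteq> B \<union> (S \<union> D) \<longrightarrow>
          \<not> quad (insert r (set zs)) a b \<subseteq> B' \<union> (S \<union> D) \<longrightarrow>
          bichromatic (c(r := k c)) (quad (insert r (set zs)) a b))"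
        by (intro exI[of _ h] exI[of _ "\<lambda>c. g r"]) blast
    qed
    moreover have "balanced (set (zs @ [r])) B' S D f"
      using balanced_insert_minimal[OF st r _ B'_def] False by simp
    ultimately show ?thesis using reduce_blanks by blast
  qed
qed

lemma online_colouring:
  assumes "distinct zs" "set zs \<subseteq> I"
  obtains c where "\<And>k a b. 12 \<le> card (quad (set (take k zs)) a b) \<Longrightarrow>
    bichromatic c (quad (set (take k zs)) a b)"
proof -
  obtain B S D f where st: "balanced (set zs) B S D f"
    and ext: "extendable zs B (S \<union> D) f" and few: "few_blanks (set zs) B (S \<union> D) f"
    using balanced_ex[OF assms] by blast
  obtain c where c: "\<forall>i\<in>S \<union> D. c i = f i"
    "\<And>a b. \<not> quad (set zs) a b \<subseteq> B \<union> (S \<union> D) \<Longrightarrow> bichromatic c (quad (set zs) a b)"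
    "\<And>k a b. k < length zs \<Longrightarrow> 12 \<le> card (quad (set (take k zs)) a b) \<Longrightarrow>
        bichromatic c (quad (set (take k zs)) a b)"
    \<comment> \<open>The blanks left at the end may be coloured arbitrarily, here all
      \<open>True\<close>.\<close>
    using spec[OF ext[unfolded extendable_def], of "\<lambda>_. True"] by blast
  have "bichromatic c (quad (set (take k zs)) a b)"
    if "12 \<le> card (quad (set (take k zs)) a b)" for k a b
  proof (cases "k < length zs")
    case False
    then show ?thesis using bichromatic_of_large[OF st few c(1) c(2)] that by simp
  qed (use c(3) that in auto)
  then show ?thesis by (rule that)
qed

end

section \<open>From triangles to quadrants\<close>

lemma set_takeWhile_sorted:
  fixes h :: "'i \<Rightarrow> 'a::linorder"
  assumes "sorted (map h zs)"
    and "\<And>i j. i \<in> set zs \<Longrightarrow> j \<in> set zs \<Longrightarrow> Q i \<Longrightarrow> h j \<le> h i \<Longrightarrow> Q j"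
  shows "set (takeWhile Q zs) = {i \<in> set zs. Q i}"
  using assms
proof (induction zs)
  case (Cons z zs)
  have IH: "set (takeWhile Q zs) = {i \<in> set zs. Q i}"
    using Cons.prems by (intro Cons.IH) auto
  show ?case
  proof (cases "Q z")
    case True
    then show ?thesis using IH by auto
  next
    case False
    then have "\<not> Q i" if "i \<in> set zs" for i
      using that Cons.prems(1) Cons.prems(2)[of i z] by auto
    then show ?thesis using False by auto
  qed
qed simp

text \<open>Strict and weak thresholds on \<open>h\<close> both cut out such sets, so open and
  closed triangles are treated alike.\<close>

definition initial :: "('i \<Rightarrow> real) \<Rightarrow> 'i set \<Rightarrow> 'i set \<Rightarrow> bool" where
  "initial h I A \<longleftrightarrow> A \<subseteq> I \<and> (\<forall>i\<in>A. \<forall>j\<in>I. h j \<le> h i \<longrightarrow> j \<in> A)"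

text \<open>Sorting by \<open>h\<close> turns threshold sets into prefixes. This yields the order of
  arrival and, through positions in the list, the coordinates.\<close>

lemma initial_take:
  assumes "finite I"
  obtains zs where "distinct zs" "set zs = I" "\<And>A. initial h I A \<Longrightarrow> \<exists>k. A = set (take k zs)"
proof -
  obtain ys where ys: "set ys = I" "distinct ys" using finite_distinct_list[OF assms] by blast
  define zs where "zs = sort_key h ys"
  have zs: "sorted (map h zs)" "set zs = I" "distinct zs" using ys by (auto simp: zs_def)
  have "\<exists>k. A = set (take k zs)" if A: "initial h I A" for A
  proof -
    have "set (takeWhile (\<lambda>i. i \<in> A) zs) = {i \<in> set zs. i \<in> A}"
      using A zs unfolding initial_def by (intro set_takeWhile_sorted[OF zs(1)]) blast
    also have "\<dots> = A" using A zs(2) by (auto simp: initial_def)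
    finally show ?thesis by (metis takeWhile_eq_take)
  qed
  with zs show ?thesis using that by blast
qed

text \<open>Ties of \<open>h\<close> are broken arbitrarily, which puts the points into general position.\<close>
lemma initial_rank:
  assumes "finite I"
  obtains x :: "'i \<Rightarrow> nat" where "inj_on x I" "\<And>A. initial h I A \<Longrightarrow> \<exists>a. A = {i \<in> I. x i < a}"
proof -
  obtain zs where zs: "distinct zs" "set zs = I"
    and init: "\<And>A. initial h I A \<Longrightarrow> \<exists>k. A = set (take k zs)"
    using initial_take[OF assms] by blast
  define x where "x = the_inv_into {..<length zs} (\<lambda>k. zs ! k)"
  have inj: "inj_on (\<lambda>k. zs ! k) {..<length zs}"
    using zs(1) by (simp add: inj_on_nth)
  have x: "x (zs ! k) = k" if "k < length zs" for k
    unfolding x_def using the_inv_into_f_f[OF inj] that by simp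
  have "inj_on x I" using x zs(2) by (auto simp: inj_on_def in_set_conv_nth)
  moreover have "set (take k zs) = {i \<in> I. x i < k}" for k
  proof -
    have "set (take k zs) = {zs ! i | i. i < length zs \<and> i < k}"
      unfolding set_conv_nth by (rule Collect_cong) (metis length_take min_less_iff_conj nth_take)
    also have "\<dots> = {i \<in> I. x i < k}"
      unfolding zs(2)[symmetric] set_conv_nth using x by auto
    finally show ?thesis .
  qed
  ultimately show ?thesis using that init by metis
qed

lemma octant_colouring:
  fixes h1 h2 h3 :: "'i \<Rightarrow> real"
  assumes "finite I"
  obtains c where "\<And>A1 A2 A3. initial h1 I A1 \<Longrightarrow> initial h2 I A2 \<Longrightarrow> initial h3 I A3 \<Longrightarrow>
    12 \<le> card (A1 \<inter> A2 \<inter> A3) \<Longrightarrow> bichromatic c (A1 \<inter> A2 \<inter> A3)"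
proof -
  obtain x :: "'i \<Rightarrow> nat" where x: "inj_on x I" "\<And>A. initial h1 I A \<Longrightarrow> \<exists>a. A = {i \<in> I. x i < a}"
    using initial_rank[OF assms] by blast
  obtain y :: "'i \<Rightarrow> nat" where y: "inj_on y I" "\<And>A. initial h2 I A \<Longrightarrow> \<exists>b. A = {i \<in> I. y i < b}"
    using initial_rank[OF assms] by blast
  obtain zs where zs: "distinct zs" "set zs = I"
    "\<And>A. initial h3 I A \<Longrightarrow> \<exists>k. A = set (take k zs)"
    using initial_take[OF assms] by blast
  interpret quadrants x y I
    using x y assms by unfold_locales
  obtain c where c: "\<And>k a b. 12 \<le> card (quad (set (take k zs)) a b) \<Longrightarrow>
      bichromatic c (quad (set (take k zs)) a b)"
    using online_colouring[OF zs(1)] zs(2) by blast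
  show ?thesis
  proof (rule that)
    fix A1 A2 A3
    assume A: "initial h1 I A1" "initial h2 I A2" "initial h3 I A3" "12 \<le> card (A1 \<inter> A2 \<inter> A3)"
    obtain a b k where "A1 = {i \<in> I. x i < a}" "A2 = {i \<in> I. y i < b}" and k: "A3 = set (take k zs)"
      using x(2)[OF A(1)] y(2)[OF A(2)] zs(3)[OF A(3)] by blast
    moreover have "set (take k zs) \<subseteq> I" using zs(2) set_take_subset by fastforce
    ultimately have "A1 \<inter> A2 \<inter> A3 = quad (set (take k zs)) a b" by (auto simp: quad_def)
    then show "bichromatic c (A1 \<inter> A2 \<inter> A3)" using c A(4) by simp
  qed
qed

section \<open>Triangles and their homothetic copies as intersections of half-planes\<close>

text \<open>Cramer's rule: \<open>m\<close> and \<open>n\<close> are the rows of the inverse of the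
  matrix with columns \<open>u\<close> and \<open>v\<close>, whose determinant \<open>d\<close> is
  nonzero.\<close>

lemma dual_basis:
  fixes u v :: "real^2"
  assumes "\<not> collinear {0, u, v}"
  obtains m n where "\<And>q. q = (m \<bullet> q) *\<^sub>R u + (n \<bullet> q) *\<^sub>R v"
    "m \<bullet> u = 1" "m \<bullet> v = 0" "n \<bullet> u = 0" "n \<bullet> v = 1"
proof -
  define d where "d = u$1 * v$2 - u$2 * v$1"
  have d: "d \<noteq> 0"
  proof
    assume 0: "d = 0"
    have "u \<noteq> 0" "v \<noteq> 0" using assms by (auto simp: collinear_lemma)
    then consider "u$1 \<noteq> 0" | "u$2 \<noteq> 0" by (auto simp: vec_eq_iff forall_2)
    then have "\<exists>c. v = c *\<^sub>R u"
    proof cases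
      case 1
      then have "v = (v$1 / u$1) *\<^sub>R u"
        using 0 by (simp add: vec_eq_iff forall_2 d_def field_simps)
      then show ?thesis by blast
    next
      case 2
      then have "v = (v$2 / u$2) *\<^sub>R u"
        using 0 by (simp add: vec_eq_iff forall_2 d_def field_simps)
      then show ?thesis by blast
    qed
    then show False using assms by (simp add: collinear_lemma)
  qed
  define m :: "real^2" where "m = vector [v$2 / d, - v$1 / d]"
  define n :: "real^2" where "n = vector [- u$2 / d, u$1 / d]"
  have m: "m \<bullet> q = (v$2 * q$1 - v$1 * q$2) / d" and n: "n \<bullet> q = (u$1 * q$2 - u$2 * q$1) / d" for q
    by (simp_all add: m_def n_def inner_vec_def sum_2 diff_divide_distrib algebra_simps)
  show ?thesis
  proof (rule that)
    show "q = (m \<bullet> q) *\<^sub>R u + (n \<bullet> q) *\<^sub>R v" for q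
    proof -
      have "d * q$1 = (v$2 * q$1 - v$1 * q$2) * u$1 + (u$1 * q$2 - u$2 * q$1) * v$1"
        "d * q$2 = (v$2 * q$1 - v$1 * q$2) * u$2 + (u$1 * q$2 - u$2 * q$1) * v$2"
        unfolding d_def by (simp_all add: algebra_simps)
      then have "q$1 = ((v$2 * q$1 - v$1 * q$2) * u$1 + (u$1 * q$2 - u$2 * q$1) * v$1) / d"
        "q$2 = ((v$2 * q$1 - v$1 * q$2) * u$2 + (u$1 * q$2 - u$2 * q$1) * v$2) / d"
        using d by (metis nonzero_mult_div_cancel_left)+
      then show ?thesis
        by (simp add: vec_eq_iff forall_2 m n add_divide_distrib)
    qed
    show "m \<bullet> u = 1" "m \<bullet> v = 0" "n \<bullet> u = 0" "n \<bullet> v = 1"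
      unfolding m n using d by (auto simp: d_def algebra_simps)
  qed
qed

text \<open>The three affine functions are the barycentric coordinates, nonnegative on the closed
  and positive on the open triangle.\<close>

lemma triangle_halfplanes:
  assumes "plane_triangle T"
  obtains R :: "real \<Rightarrow> real \<Rightarrow> bool" and n1 n2 n3 d1 d2 d3 where "R = (\<le>) \<or> R = (<)"
    "T = {p. R 0 (n1 \<bullet> p + d1) \<and> R 0 (n2 \<bullet> p + d2) \<and> R 0 (n3 \<bullet> p + d3)}"
proof -
  obtain a b c where abc: "\<not> collinear {a, b, c}"
    and T: "T = convex hull {a, b, c} \<or> T = interior (convex hull {a, b, c})"
    using assms unfolding plane_triangle_def by blast
  have "\<exists>R. (R = (\<le>) \<or> R = (<)) \<and> T = {p. \<exists>s t w. R 0 s \<and> R 0 t \<and> R 0 w \<and> s + t + w = 1 \<and>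
      s *\<^sub>R a + t *\<^sub>R b + w *\<^sub>R c = p}"
    using T
  proof
    assume "T = convex hull {a, b, c}"
    then show ?thesis
      unfolding convex_hull_3 by (intro exI[of _ "(\<le>)"]) fastforce
  next
    assume "T = interior (convex hull {a, b, c})"
    then show ?thesis
      using interior_convex_hull_3_minimal[OF abc] by (intro exI[of _ "(<)"]) simp
  qed
  then obtain R :: "real \<Rightarrow> real \<Rightarrow> bool" where R: "R = (\<le>) \<or> R = (<)"
    and TR: "T = {p. \<exists>s t w. R 0 s \<and> R 0 t \<and> R 0 w \<and> s + t + w = 1 \<and>
      s *\<^sub>R a + t *\<^sub>R b + w *\<^sub>R c = p}"
    by blast
  have "\<not> collinear {0, b - a, c - a}"
    using abc collinear_3[of b a c] by (simp add: insert_commute)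
  then obtain m n where mn: "\<And>q. q = (m \<bullet> q) *\<^sub>R (b - a) + (n \<bullet> q) *\<^sub>R (c - a)"
    "m \<bullet> (b - a) = 1" "m \<bullet> (c - a) = 0" "n \<bullet> (b - a) = 0" "n \<bullet> (c - a) = 1"
    using dual_basis by metis
  let ?t = "\<lambda>p. m \<bullet> p + - (m \<bullet> a)" and ?w = "\<lambda>p. n \<bullet> p + - (n \<bullet> a)"
    and ?s = "\<lambda>p. (- m - n) \<bullet> p + (1 + m \<bullet> a + n \<bullet> a)"
  have "p \<in> T \<longleftrightarrow> R 0 (?s p) \<and> R 0 (?t p) \<and> R 0 (?w p)" for p
  proof
    assume "p \<in> T"
    then obtain s t w where stw: "R 0 s" "R 0 t" "R 0 w" "s + t + w = 1"
      "s *\<^sub>R a + t *\<^sub>R b + w *\<^sub>R c = p"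
      unfolding TR by blast
    have s: "s = 1 - t - w" using stw(4) by simp
    have p: "p = a + t *\<^sub>R (b - a) + w *\<^sub>R (c - a)"
      unfolding stw(5)[symmetric] s by (simp add: algebra_simps)
    have "?t p = t" "?w p = w" using mn(2-5) by (simp_all add: p inner_add_right)
    moreover from this have "?s p = s"
      using stw(4) by (simp add: inner_diff_left)
    ultimately show "R 0 (?s p) \<and> R 0 (?t p) \<and> R 0 (?w p)" using stw by simp
  next
    assume r: "R 0 (?s p) \<and> R 0 (?t p) \<and> R 0 (?w p)"
    have "p - a = ?t p *\<^sub>R (b - a) + ?w p *\<^sub>R (c - a)"
      using mn(1)[of "p - a"] by (simp add: inner_diff_right)
    moreover have s: "?s p = 1 - ?t p - ?w p" by (simp add: inner_diff_left)
    ultimately have "?s p *\<^sub>R a + ?t p *\<^sub>R b + ?w p *\<^sub>R c = p"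
      by (simp add: algebra_simps)
    moreover have "?s p + ?t p + ?w p = 1" using s by simp
    ultimately show "p \<in> T" unfolding TR using r by blast
  qed
  then have "T = {p. R 0 (?s p) \<and> R 0 (?t p) \<and> R 0 (?w p)}" by (intro set_eqI) simp
  then show ?thesis by (rule that[OF R])
qed

text \<open>A homothety with positive factor keeps the inner normals of the sides, so copies differ
  only in the offsets of their sides.\<close>

lemma homothetic_copy_thresholds:
  fixes P :: "'i \<Rightarrow> (real^2) set"
  assumes "plane_triangle T" and copies: "\<forall>i\<in>I. homothetic_copy T (P i)"
  obtains h1 h2 h3 where "\<forall>q. \<exists>A1 A2 A3. initial h1 I A1 \<and> initial h2 I A2 \<and> initial h3 I A3 \<and>
    {i \<in> I. q \<in> P i} = A1 \<inter> A2 \<inter> A3"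
proof -
  obtain R :: "real \<Rightarrow> real \<Rightarrow> bool" and n1 n2 n3 d1 d2 d3 where R: "R = (\<le>) \<or> R = (<)"
    and T: "T = {p. R 0 (n1 \<bullet> p + d1) \<and> R 0 (n2 \<bullet> p + d2) \<and> R 0 (n3 \<bullet> p + d3)}"
    by (rule triangle_halfplanes[OF assms(1)])
  obtain l v where lv: "\<And>i. i \<in> I \<Longrightarrow> l i > 0 \<and> P i = (\<lambda>p. l i *\<^sub>R p + v i) ` T"
    using copies unfolding homothetic_copy_def by metis
  \<comment> \<open>On the image of the line \<open>n \<bullet> p + d = 0\<close> in copy
    \<open>i\<close>, the functional \<open>n\<close> has the value \<open>h n d i\<close>.\<close>
  define h where "h n d i = n \<bullet> v i - l i * d" for n :: "real^2" and d i
  have side: "R 0 (n \<bullet> p + d) \<longleftrightarrow> R (h n d i) (n \<bullet> (l i *\<^sub>R p + v i))" if "i \<in> I" for n d p i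
  proof -
    have "n \<bullet> (l i *\<^sub>R p + v i) - h n d i = l i * (n \<bullet> p + d)"
      by (simp add: h_def algebra_simps)
    moreover have "R 0 (l i * e) \<longleftrightarrow> R 0 e" for e
      using R lv[OF that] by (auto simp: zero_le_mult_iff zero_less_mult_iff)
    moreover have "R s t \<longleftrightarrow> R 0 (t - s)" for s t using R by auto
    ultimately show ?thesis by metis
  qed
  let ?A = "\<lambda>n d q. {i \<in> I. R (h n d i) (n \<bullet> q)}"
  have init: "initial (h n d) I (?A n d q)" for n d q
    using R unfolding initial_def by auto
  have eq: "{i \<in> I. q \<in> P i} = ?A n1 d1 q \<inter> ?A n2 d2 q \<inter> ?A n3 d3 q" for q
  proof -
    have "q \<in> P i \<longleftrightarrow> R (h n1 d1 i) (n1 \<bullet> q) \<and> R (h n2 d2 i) (n2 \<bullet> q) \<and> R (h n3 d3 i) (n3 \<bullet> q)"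
      if i: "i \<in> I" for i
    proof -
      define p where "p = (1 / l i) *\<^sub>R (q - v i)"
      have q: "q = l i *\<^sub>R p + v i" using lv[OF i] by (simp add: p_def)
      have "q \<in> P i \<longleftrightarrow> p \<in> T" using lv[OF i] q by auto
      then show ?thesis unfolding T q using side[OF i] by simp
    qed
    then show ?thesis by auto
  qed
  show ?thesis
  proof (rule that, intro allI)
    fix q
    show "\<exists>A1 A2 A3. initial (h n1 d1) I A1 \<and> initial (h n2 d2) I A2 \<and> initial (h n3 d3) I A3 \<and>
        {i \<in> I. q \<in> P i} = A1 \<inter> A2 \<inter> A3"
      using eq[of q] init[of n1 d1 q] init[of n2 d2 q] init[of n3 d3 q] by blast
  qed
qed

theorem corollary2:
  fixes T S :: "(real^2) set"
    and I :: "'i set"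
    and P :: "'i \<Rightarrow> (real^2) set"
  assumes "plane_triangle T"
    and "finite I"
    and "\<And>i. i \<in> I \<Longrightarrow> homothetic_copy T (P i)"
    and "fold_covering 12 I P S"
  shows "\<exists>I1 I2. I1 \<union> I2 = I \<and> I1 \<inter> I2 = {} \<and> covering I1 P S \<and> covering I2 P S"
proof -
  have "\<forall>i\<in>I. homothetic_copy T (P i)" using assms(3) by blast
  then obtain h1 h2 h3 where h: "\<forall>q. \<exists>A1 A2 A3. initial h1 I A1 \<and> initial h2 I A2 \<and> initial h3 I A3 \<and>
      {i \<in> I. q \<in> P i} = A1 \<inter> A2 \<inter> A3"
    by (rule homothetic_copy_thresholds[OF assms(1)])
  obtain c where c: "\<And>A1 A2 A3. initial h1 I A1 \<Longrightarrow> initial h2 I A2 \<Longrightarrow> initial h3 I A3 \<Longrightarrow>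
      12 \<le> card (A1 \<inter> A2 \<inter> A3) \<Longrightarrow> bichromatic c (A1 \<inter> A2 \<inter> A3)"
    by (rule octant_colouring[OF assms(2)]) (rule that)
  \<comment> \<open>The colouring \<open>c\<close> of the indices was fixed before \<open>q\<close>;
    its two classes are the required parts.\<close>
  have both: "\<exists>i\<in>I. q \<in> P i \<and> c i = k" if q: "q \<in> S" for q k
  proof -
    obtain J where J: "J \<subseteq> I" "card J = 12" "\<forall>i\<in>J. q \<in> P i"
      using assms(4) q unfolding fold_covering_def by blast
    then have "J \<subseteq> {i \<in> I. q \<in> P i}" by blast
    then have "12 \<le> card {i \<in> I. q \<in> P i}"
      using card_mono[of "{i \<in> I. q \<in> P i}" J] J(2) assms(2) by simp
    then have "bichromatic c {i \<in> I. q \<in> P i}" using spec[OF h, of q] c by metis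
    then show ?thesis unfolding bichromatic_def by auto
  qed
  have cov: "covering {i \<in> I. c i = k} P S" for k
    unfolding covering_def fold_covering_def
  proof
    fix q assume "q \<in> S"
    then obtain i where "i \<in> I" "q \<in> P i" "c i = k" using both by blast
    then show "\<exists>J\<subseteq>{i \<in> I. c i = k}. finite J \<and> card J = 1 \<and> (\<forall>i\<in>J. q \<in> P i)"
      by (intro exI[of _ "{i}"]) auto
  qed
  show ?thesis
    by (intro exI[of _ "{i \<in> I. c i = True}"] exI[of _ "{i \<in> I. c i = False}"] conjI cov) auto
qed

end
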